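(* Let $c>1$ and $d\ge1$ be integers such that $c$ does not divide $d$. Consider the Baumslag--Solitar group $$G=\langle a,b : ab^c=b^{-d}a\rangle .$$ Let $P$ be the unital subsemigroup of $G$ generated by $a$ and $b$. Then there is no embedding of $P$ in a group $H$ such that $(H,P)$ is quasi-lattice ordered.
   Context: An embedding of $P$ in $H$ is an injective (unital) semigroup homomorphism $P\to H$; $P$ is identified with its image. For a discrete group $H$ with a unital subsemigroup $P$ such that $P\cap P^{-1}=\{e\}$, define a left-invariant partial order on $H$ by $x\le y$ iff $x^{-1}y\in P$. The pair $(H,P)$ is quasi-lattice ordered if, for any $n\ge1$, any $x_1,\dots,x_n\in H$ which have common upper bounds in $P$ also have a least common upper bound in $P$. *)

theory Defs
  imports "HOL-Algebra.Coset"
begin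

section \<open>Groups given by generators and relations\<close>

text \<open>A word over the generators is a list of letters; the letter \<open>(x, True)\<close> stands for
  the generator \<open>x\<close> and \<open>(x, False)\<close> for its formal inverse.\<close>

type_synonym 'x gword = "('x \<times> bool) list"

definition gpow :: "'x \<Rightarrow> int \<Rightarrow> 'x gword" where
  "gpow x k = replicate (nat \<bar>k\<bar>) (x, k \<ge> 0)"

inductive pres_eq :: "('x gword \<times> 'x gword) set \<Rightarrow> 'x gword \<Rightarrow> 'x gword \<Rightarrow> bool"
  for R where
  refl: "pres_eq R u u"
| sym: "pres_eq R u v \<Longrightarrow> pres_eq R v u"
| trans: "pres_eq R u v \<Longrightarrow> pres_eq R v w \<Longrightarrow> pres_eq R u w"
| append: "pres_eq R u v \<Longrightarrow> pres_eq R u' v' \<Longrightarrow> pres_eq R (u @ u') (v @ v')"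
| cancel: "pres_eq R [(x, s), (x, \<not> s)] []"
| relation: "(l, r) \<in> R \<Longrightarrow> pres_eq R l r"

definition pres_rel :: "('x gword \<times> 'x gword) set \<Rightarrow> ('x gword \<times> 'x gword) set" where
  "pres_rel R = {(u, v). pres_eq R u v}"

definition pres_class :: "('x gword \<times> 'x gword) set \<Rightarrow> 'x gword \<Rightarrow> 'x gword set" where
  "pres_class R w = pres_rel R `` {w}"

text \<open>The set of generators is the whole type \<^typ>\<open>'x\<close>; each pair \<open>(l, r) \<in> R\<close> is the
  relation \<open>l = r\<close>.\<close>

definition presented_group :: "('x gword \<times> 'x gword) set \<Rightarrow> 'x gword set monoid" where
  "presented_group R =
     \<lparr>carrier = UNIV // pres_rel R,
      mult = (\<lambda>X Y. \<Union>u\<in>X. \<Union>v\<in>Y. pres_class R (u @ v)),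
      one = pres_class R []\<rparr>"

lemma equiv_pres_rel: "equiv UNIV (pres_rel R)"
  by (auto simp: pres_rel_def intro!: equivI refl_onI symI transI
      intro: pres_eq.refl pres_eq.sym pres_eq.trans)

lemma pres_class_eq_iff: "pres_class R u = pres_class R v \<longleftrightarrow> pres_eq R u v"
  using eq_equiv_class_iff[OF equiv_pres_rel, of u v R]
  by (simp add: pres_class_def pres_rel_def)

lemma carrier_presented_group: "carrier (presented_group R) = range (pres_class R)"
  by (auto simp: presented_group_def quotient_def pres_class_def)

lemma one_presented_group: "\<one>\<^bsub>presented_group R\<^esub> = pres_class R []"
  by (simp add: presented_group_def)

lemma mult_presented_group:
  "pres_class R u \<otimes>\<^bsub>presented_group R\<^esub> pres_class R v = pres_class R (u @ v)"
proof -
  have "pres_class R (u' @ v') = pres_class R (u @ v)"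
    if "u' \<in> pres_class R u" "v' \<in> pres_class R v" for u' v'
    using that unfolding pres_class_eq_iff
    by (auto simp: pres_class_def pres_rel_def intro: pres_eq.sym pres_eq.append)
  moreover have "w \<in> pres_class R w" for w
    by (simp add: pres_class_def pres_rel_def pres_eq.refl)
  ultimately have "(\<Union>u'\<in>pres_class R u. \<Union>v'\<in>pres_class R v. pres_class R (u' @ v')) =
      pres_class R (u @ v)"
    by blast
  then show ?thesis
    by (simp add: presented_group_def)
qed

lemma pres_eq_inverse:
  "pres_eq R (rev (map (\<lambda>(x, s). (x, \<not> s)) w) @ w) []"
proof (induction w)
  case Nil
  show ?case by (simp add: pres_eq.refl)
next
  case (Cons p w)
  obtain x s where p: "p = (x, s)" by fastforce
  let ?v = "rev (map (\<lambda>(x, s). (x, \<not> s)) w)"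
  have "pres_eq R (?v @ ([(x, \<not> s), (x, \<not> \<not> s)] @ w)) (?v @ ([] @ w))"
    by (intro pres_eq.append pres_eq.refl pres_eq.cancel)
  then show ?case
    using pres_eq.trans[OF _ Cons.IH] p by simp
qed

lemma group_presented_group: "group (presented_group R)"
proof (rule groupI)
  fix X assume "X \<in> carrier (presented_group R)"
  then obtain w where "X = pres_class R w"
    by (auto simp: carrier_presented_group)
  then show "\<exists>Y\<in>carrier (presented_group R). Y \<otimes>\<^bsub>presented_group R\<^esub> X = \<one>\<^bsub>presented_group R\<^esub>"
    using pres_eq_inverse[of R w]
    by (auto simp: carrier_presented_group mult_presented_group one_presented_group
        pres_class_eq_iff)
qed (auto simp: carrier_presented_group mult_presented_group one_presented_group)


section \<open>Baumslag--Solitar groups and their positive monoids\<close>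

datatype bs_gen = gen_a | gen_b

text \<open>The group \<open>\<langle>a, b : a b\<^sup>c = b\<^sup>k a\<rangle>\<close>.\<close>

definition baumslag_solitar :: "int \<Rightarrow> int \<Rightarrow> bs_gen gword set monoid" where
  "baumslag_solitar c k =
     presented_group {(gpow gen_a 1 @ gpow gen_b c, gpow gen_b k @ gpow gen_a 1)}"

definition bs_elem :: "int \<Rightarrow> int \<Rightarrow> bs_gen \<Rightarrow> bs_gen gword set" where
  "bs_elem c k x = pres_class {(gpow gen_a 1 @ gpow gen_b c, gpow gen_b k @ gpow gen_a 1)} [(x, True)]"

definition generated_submonoid :: "('g, 'm) monoid_scheme \<Rightarrow> 'g set \<Rightarrow> 'g set" where
  "generated_submonoid G S = \<Inter>{M. submonoid M G \<and> S \<subseteq> M}"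

definition bs_positive :: "int \<Rightarrow> int \<Rightarrow> bs_gen gword set set" where
  "bs_positive c k =
     generated_submonoid (baumslag_solitar c k) {bs_elem c k gen_a, bs_elem c k gen_b}"

lemma group_baumslag_solitar: "group (baumslag_solitar c k)"
  by (simp add: baumslag_solitar_def group_presented_group)

lemma bs_elem_closed: "bs_elem c k x \<in> carrier (baumslag_solitar c k)"
  by (simp add: bs_elem_def baumslag_solitar_def carrier_presented_group)

lemma pres_class_gpow:
  "pres_class R (gpow x k) = pres_class R [(x, True)] [^]\<^bsub>presented_group R\<^esub> k"
proof -
  interpret group "presented_group R" by (rule group_presented_group)
  have nat_pow: "pres_class R (replicate n p) = pres_class R [p] [^]\<^bsub>presented_group R\<^esub> n" for n p
  proof (induction n)
    case (Suc n)
    show ?case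
      by (simp add: mult_presented_group replicate_append_same flip: Suc)
  qed (simp add: one_presented_group)
  have "pres_class R [(x, False)] \<otimes>\<^bsub>presented_group R\<^esub> pres_class R [(x, True)] =
      \<one>\<^bsub>presented_group R\<^esub>"
    using pres_eq.cancel[of R x False]
    by (simp add: mult_presented_group one_presented_group pres_class_eq_iff)
  then have inv: "inv\<^bsub>presented_group R\<^esub> pres_class R [(x, True)] = pres_class R [(x, False)]"
    by (intro inv_equality) (simp_all add: carrier_presented_group)
  have closed: "pres_class R [(x, True)] \<in> carrier (presented_group R)"
    by (simp add: carrier_presented_group)
  show ?thesis
  proof (cases "k < 0")
    case True
    then have "gpow x k = replicate (nat (- k)) (x, False)"
      by (simp add: gpow_def)
    with True show ?thesis
      by (simp only: nat_pow int_pow_def2 if_True inv flip: nat_pow_inv[OF closed])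
  next
    case False
    then have "gpow x k = replicate (nat k) (x, True)"
      by (simp add: gpow_def)
    with False show ?thesis
      by (simp only: nat_pow int_pow_def2 if_False)
  qed
qed

lemma baumslag_solitar_relation:
  fixes c k :: int
  defines "G \<equiv> baumslag_solitar c k"
    and "a \<equiv> bs_elem c k gen_a"
    and "b \<equiv> bs_elem c k gen_b"
  shows "a \<otimes>\<^bsub>G\<^esub> b [^]\<^bsub>G\<^esub> c = b [^]\<^bsub>G\<^esub> k \<otimes>\<^bsub>G\<^esub> a"
proof -
  let ?R = "{(gpow gen_a 1 @ gpow gen_b c, gpow gen_b k @ gpow gen_a 1)}"
  have "pres_class ?R (gpow gen_a 1 @ gpow gen_b c) = pres_class ?R (gpow gen_b k @ gpow gen_a 1)"
    unfolding pres_class_eq_iff by (rule pres_eq.relation) simp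
  moreover have "gpow gen_a 1 = [(gen_a, True)]"
    by (simp add: gpow_def)
  ultimately show ?thesis
    unfolding G_def a_def b_def bs_elem_def baumslag_solitar_def
    by (simp only: mult_presented_group flip: pres_class_gpow)
qed


section \<open>Quasi-lattice ordered groups\<close>

definition monoid_order :: "('h, 'm) monoid_scheme \<Rightarrow> 'h set \<Rightarrow> 'h gorder" where
  "monoid_order H P =
     \<lparr>carrier = carrier H, eq = (=), le = (\<lambda>x y. inv\<^bsub>H\<^esub> x \<otimes>\<^bsub>H\<^esub> y \<in> P)\<rparr>"

text \<open>Families \<open>x\<^sub>1, \<dots>, x\<^sub>n\<close> with \<open>n \<ge> 1\<close> enter only through their (nonempty, finite) set of
  members. The elements \<open>x\<^sub>i\<close> range over all of \<open>H\<close>, whereas both the upper bounds and the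
  least one among them are taken in \<open>P\<close>.\<close>

definition quasi_lattice_ordered :: "('h, 'm) monoid_scheme \<Rightarrow> 'h set \<Rightarrow> bool" where
  "quasi_lattice_ordered H P \<longleftrightarrow>
     group H \<and> submonoid P H \<and> P \<inter> set_inv\<^bsub>H\<^esub> P = {\<one>\<^bsub>H\<^esub>} \<and>
     (\<forall>X. finite X \<and> X \<noteq> {} \<and> X \<subseteq> carrier H \<and> Upper (monoid_order H P) X \<inter> P \<noteq> {} \<longrightarrow>
        (\<exists>z. least (monoid_order H P) z (Upper (monoid_order H P) X \<inter> P)))"

definition unital_embedding ::
  "('g, 'm) monoid_scheme \<Rightarrow> 'g set \<Rightarrow> ('h, 'n) monoid_scheme \<Rightarrow> ('g \<Rightarrow> 'h) \<Rightarrow> bool" where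
  "unital_embedding G P H f \<longleftrightarrow> f \<in> mon (G\<lparr>carrier := P\<rparr>) H \<and> f \<one>\<^bsub>G\<^esub> = \<one>\<^bsub>H\<^esub>"

end

theory Submission
  imports Defs Complex_Main
begin

text \<open>
  In \<open>P\<close> we have \<open>a = b\<^sup>d a b\<^sup>c\<close>, so \<open>a b\<^sup>k \<in> P\<close> for every integer \<open>k\<close>. Suppose \<open>P\<close> sits in a
  quasi-lattice ordered \<open>(H, P)\<close> and put \<open>x = a b a\<^sup>-\<^sup>1 \<in> H\<close>. Since \<open>x a b\<^bsup>k-1\<^esup> = a b\<^sup>k\<close>, all
  \<open>a b\<^sup>k\<close> are upper bounds of \<open>x\<close> in \<open>P\<close>. Let \<open>p\<close> be the least upper bound, \<open>p = x r\<close> and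
  \<open>a b\<^sup>k = p q\<^sub>k\<close> with \<open>r, q\<^sub>k \<in> P\<close>. Then \<open>p q\<^sub>k = a b\<^sup>k\<close> and \<open>r q\<^sub>k = a b\<^bsup>k-1\<^esup>\<close>, and these
  identities hold in \<open>P\<close>, hence in \<open>G\<close>, where the exponent sum of \<open>a\<close> and the affine action
  \<open>a y = - (d / c) y\<close>, \<open>b y = y + 1\<close> on the rationals refute them. If \<open>p\<close> has \<open>a\<close>-exponent
  \<open>1\<close>, then every \<open>q\<^sub>k\<close> is a nonnegative translation, yet the translation lengths are \<open>k\<close> plus
  a constant. If it has \<open>a\<close>-exponent \<open>0\<close>, then \<open>p\<close> and \<open>r\<close> are integral translations whose
  difference is \<open>- d / c\<close>, so \<open>c\<close> divides \<open>d\<close>.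
\<close>

section \<open>Actions of presented groups\<close>

text \<open>\<open>foldr\<close> turns concatenation of words into composition of maps, so only
  \<open>cancel\<close> and \<open>relation\<close> constrain the letters' maps.\<close>

lemma pres_eq_foldr:
  assumes "pres_eq R u v"
    and inv: "\<And>x s y. \<phi> (x, s) (\<phi> (x, \<not> s) y) = y"
    and rel: "\<And>l r. (l, r) \<in> R \<Longrightarrow> foldr \<phi> l = foldr \<phi> r"
  shows "foldr \<phi> u = foldr \<phi> v"
  using assms(1)
proof induction
  case (cancel x s)
  show ?case by (simp add: fun_eq_iff inv)
qed (simp_all add: rel)

lemma presented_group_action:
  assumes "\<And>x s y. \<phi> (x, s) (\<phi> (x, \<not> s) y) = y"
    and "\<And>l r. (l, r) \<in> R \<Longrightarrow> foldr \<phi> l = foldr \<phi> r"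
  obtains \<Phi> where "\<And>w. \<Phi> (pres_class R w) = foldr \<phi> w"
proof
  fix w
  have "pres_class R w = pres_class R (SOME v. pres_class R w = pres_class R v)"
    by (rule someI) (rule HOL.refl)
  then show "foldr \<phi> (SOME v. pres_class R w = pres_class R v) = foldr \<phi> w"
    unfolding pres_class_eq_iff by (metis pres_eq_foldr assms)
qed

text \<open>The integer coordinate carries the exponent sum of \<open>a\<close>, the rational one
  the affine action.\<close>

fun bs_letter_act :: "rat \<Rightarrow> bs_gen \<times> bool \<Rightarrow> int \<times> rat \<Rightarrow> int \<times> rat" where
  "bs_letter_act \<alpha> (gen_a, True) (h, y) = (h + 1, \<alpha> * y)"
| "bs_letter_act \<alpha> (gen_a, False) (h, y) = (h - 1, y / \<alpha>)"
| "bs_letter_act \<alpha> (gen_b, True) (h, y) = (h, y + 1)"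
| "bs_letter_act \<alpha> (gen_b, False) (h, y) = (h, y - 1)"

lemma foldr_bs_letter_act_gpow_b:
  "foldr (bs_letter_act \<alpha>) (gpow gen_b k) (h, y) = (h, y + of_int k)"
proof -
  have "foldr (bs_letter_act \<alpha>) (replicate n (gen_b, s)) (h, y) =
      (h, if s then y + of_nat n else y - of_nat n)" for n s
    by (induction n) auto
  then show ?thesis by (simp add: gpow_def)
qed

text \<open>With \<alpha> = k / c, both sides of the relation send y to \<alpha> y + k and raise the
  integer coordinate by 1, so the letter action descends to the group.\<close>

lemma baumslag_solitar_affine_action:
  fixes c k :: int
  assumes "c \<noteq> 0" and "k \<noteq> 0"
  defines "G \<equiv> baumslag_solitar c k"
    and "a \<equiv> bs_elem c k gen_a"
    and "b \<equiv> bs_elem c k gen_b"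
  obtains \<Phi> :: "bs_gen gword set \<Rightarrow> int \<times> rat \<Rightarrow> int \<times> rat"
  where "\<And>g h y. \<lbrakk>g \<in> carrier G; h \<in> carrier G\<rbrakk> \<Longrightarrow> \<Phi> (g \<otimes>\<^bsub>G\<^esub> h) y = \<Phi> g (\<Phi> h y)"
    and "\<And>y. \<Phi> \<one>\<^bsub>G\<^esub> y = y"
    and "\<And>h y. \<Phi> a (h, y) = (h + 1, of_int k / of_int c * y)"
    and "\<And>j h y. \<Phi> (b [^]\<^bsub>G\<^esub> (j::int)) (h, y) = (h, y + of_int j)"
proof -
  let ?R = "{(gpow gen_a 1 @ gpow gen_b c, gpow gen_b k @ gpow gen_a 1)}"
  let ?\<alpha> = "of_int k / of_int c :: rat"
  let ?\<phi> = "bs_letter_act ?\<alpha>"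
  have "?\<phi> (x, s) (?\<phi> (x, \<not> s) y) = y" for x s y
    using assms(1,2) by (cases x; cases s; cases y) auto
  moreover have "foldr ?\<phi> (gpow gen_a 1 @ gpow gen_b c) = foldr ?\<phi> (gpow gen_b k @ gpow gen_a 1)"
  proof
    fix y :: "int \<times> rat"
    have "gpow gen_a 1 = [(gen_a, True)]" by (simp add: gpow_def)
    then show "foldr ?\<phi> (gpow gen_a 1 @ gpow gen_b c) y = foldr ?\<phi> (gpow gen_b k @ gpow gen_a 1) y"
      using assms(1) by (cases y) (simp add: foldr_bs_letter_act_gpow_b field_simps)
  qed
  ultimately obtain \<Phi> where \<Phi>: "\<And>w. \<Phi> (pres_class ?R w) = foldr ?\<phi> w"
    using presented_group_action[of ?\<phi> ?R] by blast
  show thesis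
  proof
    fix g h y assume "g \<in> carrier G" "h \<in> carrier G"
    then show "\<Phi> (g \<otimes>\<^bsub>G\<^esub> h) y = \<Phi> g (\<Phi> h y)"
      by (auto simp: G_def baumslag_solitar_def carrier_presented_group mult_presented_group \<Phi>)
  next
    show "\<Phi> (b [^]\<^bsub>G\<^esub> j) (h, y) = (h, y + of_int j)" for j :: int and h y
      unfolding b_def G_def bs_elem_def baumslag_solitar_def
      by (simp only: \<Phi> foldr_bs_letter_act_gpow_b flip: pres_class_gpow)
  qed (simp_all add: G_def a_def baumslag_solitar_def bs_elem_def one_presented_group \<Phi>)
qed

section \<open>The positive monoid\<close>

lemma submonoid_generated_submonoid:
  assumes "monoid G" and "S \<subseteq> carrier G"
  shows "submonoid (generated_submonoid G S) G"
proof -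
  interpret monoid G by fact
  have "submonoid (carrier G) G" by (simp add: submonoid_def)
  with assms(2) have "generated_submonoid G S \<subseteq> carrier G"
    by (auto simp: generated_submonoid_def)
  then show ?thesis
    by (rule submonoid.intro) (auto simp: generated_submonoid_def
        intro: submonoid.m_closed submonoid.one_closed)
qed

lemma generated_submonoid_incl: "S \<subseteq> generated_submonoid G S"
  by (auto simp: generated_submonoid_def)

lemma generated_submonoid_least:
  "\<lbrakk>submonoid M G; S \<subseteq> M\<rbrakk> \<Longrightarrow> generated_submonoid G S \<subseteq> M"
  by (auto simp: generated_submonoid_def)

lemma submonoid_bs_positive: "submonoid (bs_positive c k) (baumslag_solitar c k)"
  unfolding bs_positive_def
  by (intro submonoid_generated_submonoid group.is_monoid group_baumslag_solitar)
     (auto simp: bs_elem_closed)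

lemma bs_elem_positive: "bs_elem c k x \<in> bs_positive c k"
  unfolding bs_positive_def
  using generated_submonoid_incl[of "{bs_elem c k gen_a, bs_elem c k gen_b}"]
  by (cases x) auto

lemma (in submonoid) nat_pow_mem:
  "monoid G \<Longrightarrow> x \<in> H \<Longrightarrow> x [^] (n::nat) \<in> H"
  by (induction n) (auto simp: monoid.nat_pow_0 monoid.nat_pow_Suc)

text \<open>Iterating the relation gives \<open>a = b^(d n) a b^(c n)\<close> in \<open>G\<close>. A
  negative power of \<open>b\<close> on the right is absorbed once \<open>c n + k\<close> is
  nonnegative; n = |k| achieves this because c \<ge> 1.\<close>

lemma bs_positive_a_pow_b:
  fixes c d :: int and G (structure)
  assumes "c \<ge> 1" and "d \<ge> 0"
  defines G_def: "G \<equiv> baumslag_solitar c (- d)"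
    and "a \<equiv> bs_elem c (- d) gen_a"
    and "b \<equiv> bs_elem c (- d) gen_b"
  shows "a \<otimes> b [^] (k::int) \<in> bs_positive c (- d)"
proof -
  interpret group G unfolding G_def by (rule group_baumslag_solitar)
  interpret P: submonoid "bs_positive c (- d)" G unfolding G_def by (rule submonoid_bs_positive)
  have ab: "a \<in> carrier G" "b \<in> carrier G" "a \<in> bs_positive c (- d)" "b \<in> bs_positive c (- d)"
    by (simp_all add: a_def b_def G_def bs_elem_closed bs_elem_positive)
  have pow: "b [^] j \<in> bs_positive c (- d)" if "j \<ge> 0" for j :: int
    using that P.nat_pow_mem[OF is_monoid ab(4), of "nat j"] ab(2) by (simp flip: int_pow_int)
  have rel: "a \<otimes> b [^] c = b [^] (- d) \<otimes> a"
    unfolding a_def b_def G_def by (rule baumslag_solitar_relation)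
  have relpow: "a \<otimes> b [^] (c * int n) = b [^] (- d * int n) \<otimes> a" for n
  proof (induction n)
    case (Suc n)
    have "a \<otimes> b [^] (c * int (Suc n)) = (a \<otimes> b [^] (c * int n)) \<otimes> b [^] c"
      using ab by (simp add: m_assoc int_pow_mult[symmetric] algebra_simps)
    also have "\<dots> = b [^] (- d * int n) \<otimes> (a \<otimes> b [^] c)"
      unfolding Suc using ab by (simp add: m_assoc)
    also have "\<dots> = b [^] (- d * int n) \<otimes> b [^] (- d) \<otimes> a"
      unfolding rel using ab by (simp add: m_assoc)
    also have "\<dots> = b [^] (- d * int (Suc n)) \<otimes> a"
      using ab by (simp add: int_pow_mult[symmetric] algebra_simps)
    finally show ?case .
  qed (use ab in simp)
  define n where "n = nat \<bar>k\<bar>"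
  have n: "c * int n + k \<ge> 0"
    using mult_mono[of 1 c "\<bar>k\<bar>" "\<bar>k\<bar>"] assms(1) by (simp add: n_def)
  have "b [^] (d * int n) \<otimes> a \<otimes> b [^] (c * int n + k) =
      b [^] (d * int n) \<otimes> (a \<otimes> b [^] (c * int n)) \<otimes> b [^] k"
    using ab by (simp add: m_assoc int_pow_mult)
  also have "\<dots> = (b [^] (d * int n) \<otimes> b [^] (- d * int n)) \<otimes> a \<otimes> b [^] k"
    unfolding relpow using ab by (simp add: m_assoc)
  also have "\<dots> = a \<otimes> b [^] k"
    using ab by (simp add: int_pow_mult[symmetric])
  finally have "a \<otimes> b [^] k = b [^] (d * int n) \<otimes> a \<otimes> b [^] (c * int n + k)" ..
  then show ?thesis
    using ab pow[OF n] pow[of "d * int n"] assms(2) by simp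
qed

theorem proposition3p10:
  fixes c d :: int
  assumes "c > 1" and "d \<ge> 1" and "\<not> c dvd d"
  shows "\<not> (\<exists>(H :: 'h monoid) f.
           group H \<and>
           unital_embedding (baumslag_solitar c (- d)) (bs_positive c (- d)) H f \<and>
           quasi_lattice_ordered H (f ` bs_positive c (- d)))"
proof clarify
  fix H :: "'h monoid" and f
  assume "group H"
    and emb: "unital_embedding (baumslag_solitar c (- d)) (bs_positive c (- d)) H f"
    and qlo: "quasi_lattice_ordered H (f ` bs_positive c (- d))"
  define G where "G = baumslag_solitar c (- d)"
  define P where "P = bs_positive c (- d)"
  define a where "a = bs_elem c (- d) gen_a"
  define b where "b = bs_elem c (- d) gen_b"
  define \<alpha> :: rat where "\<alpha> = of_int (- d) / of_int c"
  define u where "u k = a \<otimes>\<^bsub>G\<^esub> b [^]\<^bsub>G\<^esub> (k::int)" for k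
  interpret G: group G unfolding G_def by (rule group_baumslag_solitar)
  interpret H: group H by fact
  interpret P: submonoid P G unfolding G_def P_def by (rule submonoid_bs_positive)
  have ab: "a \<in> P" "b \<in> P"
    by (simp_all add: a_def b_def P_def bs_elem_positive)
  have u_P: "u k \<in> P" for k
    using bs_positive_a_pow_b[of c d k] assms unfolding u_def a_def b_def G_def P_def by simp
  have \<alpha>0: "\<alpha> \<noteq> 0" using assms by (simp add: \<alpha>_def)

  have cd: "c \<noteq> 0" "- d \<noteq> 0" using assms by simp_all
  obtain \<Phi> :: "bs_gen gword set \<Rightarrow> int \<times> rat \<Rightarrow> int \<times> rat"
    where \<Phi>_mult: "\<And>g h y. \<lbrakk>g \<in> carrier G; h \<in> carrier G\<rbrakk> \<Longrightarrow> \<Phi> (g \<otimes>\<^bsub>G\<^esub> h) y = \<Phi> g (\<Phi> h y)"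
    and \<Phi>_one: "\<And>y. \<Phi> \<one>\<^bsub>G\<^esub> y = y"
    and \<Phi>_a: "\<And>h y. \<Phi> a (h, y) = (h + 1, \<alpha> * y)"
    and \<Phi>_b: "\<And>j h y. \<Phi> (b [^]\<^bsub>G\<^esub> (j::int)) (h, y) = (h, y + of_int j)"
    apply (rule baumslag_solitar_affine_action[of c "- d", folded G_def a_def b_def \<alpha>_def, OF cd])
    subgoal for \<Phi> by (rule that[of \<Phi>]) simp_all
    done
  have \<Phi>_u: "\<Phi> (u k) (h, y) = (h + 1, \<alpha> * (y + of_int k))" for k h y
    unfolding u_def using ab by (simp add: \<Phi>_mult \<Phi>_a \<Phi>_b)

  \<comment> \<open>The condition on \<beta> survives products: \<open>n + n' = 0\<close> forces
    both factors to be translations by natural numbers, and these add.\<close>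
  define M where "M = {g \<in> carrier G. \<exists>n \<beta>. (\<forall>h y. \<Phi> g (h, y) = (h + int n, \<alpha> ^ n * y + \<beta>)) \<and>
    (n = 0 \<longrightarrow> \<beta> \<in> \<nat>)}"
  have "P \<subseteq> M"
    unfolding P_def bs_positive_def
  proof (rule generated_submonoid_least)
    show "submonoid M (baumslag_solitar c (- d))"
      unfolding G_def[symmetric]
    proof (rule submonoid.intro)
      show "\<one>\<^bsub>G\<^esub> \<in> M"
        by (auto simp: M_def \<Phi>_one intro!: exI[of _ "0::nat"] exI[of _ "0::rat"])
    next
      fix g g' assume "g \<in> M" "g' \<in> M"
      then obtain n \<beta> n' \<beta>'
        where g: "g \<in> carrier G" "\<And>h y. \<Phi> g (h, y) = (h + int n, \<alpha> ^ n * y + \<beta>)"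
            "n = 0 \<Longrightarrow> \<beta> \<in> \<nat>"
          and g': "g' \<in> carrier G" "\<And>h y. \<Phi> g' (h, y) = (h + int n', \<alpha> ^ n' * y + \<beta>')"
            "n' = 0 \<Longrightarrow> \<beta>' \<in> \<nat>"
        unfolding M_def by auto
      have "\<Phi> (g \<otimes>\<^bsub>G\<^esub> g') (h, y) =
          (h + int (n + n'), \<alpha> ^ (n + n') * y + (\<alpha> ^ n * \<beta>' + \<beta>))" for h y
        using g g' by (simp add: \<Phi>_mult power_add algebra_simps)
      moreover have "\<alpha> ^ n * \<beta>' + \<beta> \<in> \<nat>" if "n + n' = 0"
        using that g(3) g'(3) by simp
      ultimately show "g \<otimes>\<^bsub>G\<^esub> g' \<in> M"
        using g(1) g'(1) unfolding M_def by blast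
    qed (auto simp: M_def)
    have "b \<in> carrier G" using ab by simp
    then have "\<Phi> b (h, y) = (h, y + 1)" for h y
      using \<Phi>_b[of 1 h y] by simp
    then have "b \<in> M"
      using ab by (auto simp: M_def intro!: exI[of _ "0::nat"] exI[of _ "1::rat"])
    moreover have "a \<in> M"
      using ab by (auto simp: M_def \<Phi>_a intro!: exI[of _ "1::nat"] exI[of _ "0::rat"])
    ultimately show "{bs_elem c (- d) gen_a, bs_elem c (- d) gen_b} \<subseteq> M"
      by (simp add: a_def b_def)
  qed
  then have affine: "\<exists>n \<beta>. (\<forall>h y. \<Phi> g (h, y) = (h + int n, \<alpha> ^ n * y + \<beta>)) \<and> (n = 0 \<longrightarrow> \<beta> \<in> \<nat>)"
    if "g \<in> P" for g
    using that unfolding M_def by blast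

  \<comment> \<open>Transfer to \<open>H\<close>\<close>
  have f_mem: "f p \<in> carrier H" if "p \<in> P" for p
    using that emb by (auto simp: unital_embedding_def mon_def hom_def P_def)
  have f_mult: "f (p \<otimes>\<^bsub>G\<^esub> q) = f p \<otimes>\<^bsub>H\<^esub> f q" if "p \<in> P" "q \<in> P" for p q
    using that emb by (auto simp: unital_embedding_def mon_def hom_def P_def G_def)
  have f_inj: "p = q" if "f p = f q" "p \<in> P" "q \<in> P" for p q
    using that emb by (auto simp: unital_embedding_def mon_def P_def dest: inj_onD)
  have f_one: "f \<one>\<^bsub>G\<^esub> = \<one>\<^bsub>H\<^esub>"
    using emb by (simp add: unital_embedding_def G_def)

  define A where "A = f a"
  define B where "B = f b"
  have AB: "A \<in> carrier H" "B \<in> carrier H"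
    using ab by (simp_all add: A_def B_def f_mem)
  have b_pow: "b [^]\<^bsub>G\<^esub> n \<in> P \<and> f (b [^]\<^bsub>G\<^esub> n) = B [^]\<^bsub>H\<^esub> n" for n :: nat
    using ab by (induction n) (simp_all add: f_one f_mult B_def)
  \<comment> \<open>Multiplicativity of \<open>f\<close> is available only on \<open>P\<close>, so a
    negative power of \<open>b\<close> cannot be split off directly. Multiplying by
    \<open>b^n\<close> with n = |k| makes all exponents nonnegative, and \<open>B^n\<close> is then
    cancelled in \<open>H\<close>.\<close>
  have f_u: "f (u k) = A \<otimes>\<^bsub>H\<^esub> B [^]\<^bsub>H\<^esub> k" for k
  proof -
    define n where "n = nat \<bar>k\<bar>"
    define m where "m = nat (k + \<bar>k\<bar>)"
    have nm: "int m = k + int n" unfolding m_def n_def by arith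
    have "u k \<otimes>\<^bsub>G\<^esub> b [^]\<^bsub>G\<^esub> n = a \<otimes>\<^bsub>G\<^esub> b [^]\<^bsub>G\<^esub> m"
      using ab unfolding u_def int_pow_int[symmetric, of G b] nm
      by (simp add: G.m_assoc G.int_pow_mult)
    then have "f (u k) \<otimes>\<^bsub>H\<^esub> B [^]\<^bsub>H\<^esub> n = A \<otimes>\<^bsub>H\<^esub> B [^]\<^bsub>H\<^esub> m"
      using f_mult[OF u_P[of k], of "b [^]\<^bsub>G\<^esub> n"] f_mult[OF ab(1), of "b [^]\<^bsub>G\<^esub> m"] b_pow
      by (simp add: A_def)
    also have "\<dots> = (A \<otimes>\<^bsub>H\<^esub> B [^]\<^bsub>H\<^esub> k) \<otimes>\<^bsub>H\<^esub> B [^]\<^bsub>H\<^esub> n"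
      using AB unfolding int_pow_int[symmetric, of H B] nm
      by (simp add: H.m_assoc H.int_pow_mult)
    finally show ?thesis
      using AB f_mem[OF u_P] by simp
  qed

  \<comment> \<open>The least upper bound\<close>
  define x where "x = A \<otimes>\<^bsub>H\<^esub> B \<otimes>\<^bsub>H\<^esub> inv\<^bsub>H\<^esub> A"
  have x: "x \<in> carrier H" using AB by (simp add: x_def)
  have x_u: "inv\<^bsub>H\<^esub> x \<otimes>\<^bsub>H\<^esub> f (u k) = f (u (k - 1))" for k
  proof -
    have "x \<otimes>\<^bsub>H\<^esub> f (u (k - 1)) = A \<otimes>\<^bsub>H\<^esub> (B \<otimes>\<^bsub>H\<^esub> B [^]\<^bsub>H\<^esub> (k - 1))"
      using AB by (simp add: x_def f_u H.m_assoc H.inv_solve_left')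
    also have "B \<otimes>\<^bsub>H\<^esub> B [^]\<^bsub>H\<^esub> (k - 1) = B [^]\<^bsub>H\<^esub> (1 + (k - 1))"
      using AB by (simp only: H.int_pow_mult H.int_pow_1)
    also have "A \<otimes>\<^bsub>H\<^esub> B [^]\<^bsub>H\<^esub> (1 + (k - 1)) = f (u k)"
      by (simp add: f_u)
    finally show ?thesis
      using x f_mem[OF u_P] by (metis H.inv_solve_left)
  qed
  let ?U = "Upper (monoid_order H (f ` P)) {x} \<inter> f ` P"
  have U: "?U = {z \<in> f ` P. inv\<^bsub>H\<^esub> x \<otimes>\<^bsub>H\<^esub> z \<in> f ` P}"
    using x f_mem by (auto simp: Upper_def monoid_order_def)
  have u_U: "f (u k) \<in> ?U" for k
    unfolding U using u_P by (simp add: x_u)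
  have "{x} \<subseteq> carrier H" "?U \<noteq> {}" using u_U x by blast+
  then obtain z where z: "least (monoid_order H (f ` P)) z ?U"
    using qlo unfolding quasi_lattice_ordered_def P_def[symmetric]
    by (metis finite.emptyI finite_insert insert_not_empty)
  then obtain p r where p: "p \<in> P" "z = f p" and r: "r \<in> P" "inv\<^bsub>H\<^esub> x \<otimes>\<^bsub>H\<^esub> f p = f r"
    using U unfolding least_def by auto
  have "\<exists>q\<in>P. inv\<^bsub>H\<^esub> f p \<otimes>\<^bsub>H\<^esub> f (u k) = f q" for k
    using z u_U[of k] p unfolding least_def by (auto simp: monoid_order_def)
  then obtain q where q: "\<And>k. q k \<in> P" and fq: "\<And>k. inv\<^bsub>H\<^esub> f p \<otimes>\<^bsub>H\<^esub> f (u k) = f (q k)"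
    by metis
  \<comment> \<open>The element \<open>x\<close> is known only in \<open>H\<close>, so the
    factorizations are derived there. Their two sides lie in the image of \<open>P\<close>, and
    injectivity of \<open>f\<close> brings them back to \<open>G\<close>.\<close>
  have f_pq: "f p \<otimes>\<^bsub>H\<^esub> f (q k) = f (u k)" for k
    using f_mem[OF p(1)] f_mem[OF u_P] by (simp add: H.m_assoc[symmetric] flip: fq)
  have pq: "p \<otimes>\<^bsub>G\<^esub> q k = u k" for k
    using f_pq p(1) q u_P by (intro f_inj) (simp_all add: f_mult)
  have "f r \<otimes>\<^bsub>H\<^esub> f (q k) = f (u (k - 1))" for k
    using x f_mem p(1) q by (simp add: H.m_assoc f_pq x_u flip: r(2))
  then have rq: "r \<otimes>\<^bsub>G\<^esub> q k = u (k - 1)" for k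
    using r(1) q u_P by (intro f_inj) (simp_all add: f_mult)

  \<comment> \<open>Comparison of exponents and translation parts\<close>
  obtain np \<beta>p where p_act: "\<And>h y. \<Phi> p (h, y) = (h + int np, \<alpha> ^ np * y + \<beta>p)" "np = 0 \<Longrightarrow> \<beta>p \<in> \<nat>"
    using affine[OF p(1)] by blast
  obtain nr \<beta>r where r_act: "\<And>h y. \<Phi> r (h, y) = (h + int nr, \<alpha> ^ nr * y + \<beta>r)" "nr = 0 \<Longrightarrow> \<beta>r \<in> \<nat>"
    using affine[OF r(1)] by blast
  have q_act: "\<exists>nq \<beta>q. np + nq = 1 \<and> nr + nq = 1 \<and> (nq = 0 \<longrightarrow> \<beta>q \<in> \<nat>) \<and>
      \<alpha> ^ np * \<beta>q + \<beta>p = \<alpha> * of_int k \<and> \<alpha> ^ nr * \<beta>q + \<beta>r = \<alpha> * of_int (k - 1)" for k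
  proof -
    obtain nq \<beta>q where *: "\<And>h y. \<Phi> (q k) (h, y) = (h + int nq, \<alpha> ^ nq * y + \<beta>q)" "nq = 0 \<longrightarrow> \<beta>q \<in> \<nat>"
      using affine[OF q] by blast
    \<comment> \<open>Evaluation at the origin isolates the exponent sums in the first coordinate
      and the translation parts in the second.\<close>
    have "\<Phi> p (\<Phi> (q k) (0, 0)) = \<Phi> (u k) (0, 0)" "\<Phi> r (\<Phi> (q k) (0, 0)) = \<Phi> (u (k - 1)) (0, 0)"
      using p(1) r(1) q[of k] by (simp_all add: pq rq flip: \<Phi>_mult)
    then show ?thesis
      using * by (intro exI[of _ nq] exI[of _ \<beta>q]) (simp add: p_act r_act \<Phi>_u)
  qed
  show False
  proof (cases "np = 0")
    case True
    \<comment> \<open>A single k suffices here: the unknown \<beta>q drops out of the difference of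
      the two equations.\<close>
    with q_act[of 0] obtain \<beta>q where "nr = 0" "\<beta>q + \<beta>p = 0" "\<beta>q + \<beta>r = - \<alpha>"
      by auto
    with True p_act(2) r_act(2) have "\<alpha> = \<beta>p - \<beta>r" "\<beta>p \<in> \<int>" "\<beta>r \<in> \<int>"
      by (auto intro: subsetD[OF Nats_subset_Ints])
    then have "\<alpha> \<in> \<int>" by simp
    then obtain m where "\<alpha> = of_int m" by (auto elim: Ints_cases)
    then have "of_int (- d) = (of_int (c * m) :: rat)"
      using assms(1) by (simp add: \<alpha>_def field_simps)
    then have "- d = c * m" by (simp only: of_int_eq_iff)
    then show False using assms(3) by (metis dvd_triv_left dvd_minus_iff)
  next
    case False
    with q_act[of 0] have np: "np = 1" by auto
    \<comment> \<open>Now \<open>nq = 0\<close>, so \<beta>q is a natural number for every integer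
      k, including arbitrarily negative ones; this bounds the integers from below.\<close>
    have "\<exists>\<beta>q\<in>\<nat>. \<beta>q = of_int k - \<beta>p / \<alpha>" for k
      using q_act[of k] np \<alpha>0 by (auto simp: field_simps)
    then have "of_int k - \<beta>p / \<alpha> \<ge> 0" for k
      by (metis Nats_cases of_nat_0_le_iff)
    then have "\<beta>p / \<alpha> \<le> of_int k" for k by simp
    then show False
      by (metis ex_of_int_less not_le)
  qed
qed

end
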